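(* For every $k\geq2$ there is a graph $G$ such that $\mathrm{stw}(G)+1\leq k+1\leq\mathrm{ca}_f(G)$.
   Context: All graphs are finite and simple. A simple $k$-tree is a graph obtainable by starting with a $(k+1)$-clique and repeatedly adding a new vertex adjacent exactly to the vertices of some $k$-clique of the current graph, such that no two vertices are added onto the same $k$-clique; $\mathrm{stw}(G)$ is the minimum $k$ such that $G$ is a subgraph of some simple $k$-tree. A caterpillar is a tree whose non-leaf vertices form a path; a caterpillar forest is a disjoint union of caterpillars. The folded caterpillar arboricity $\mathrm{ca}_f(G)$ is the minimum, over all edge-surjective graph homomorphisms $\varphi$ from a caterpillar forest to $G$, of $\max_{v\in V(G)}|\varphi^{-1}(v)|$. *)

theory Defs
  imports Main
begin

datatype 'a graph = Graph (verts: "'a set") (edges: "'a set set")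

definition simple_graph :: "'a graph \<Rightarrow> bool" where
  "simple_graph G \<longleftrightarrow> finite (verts G) \<and> (\<forall>e\<in>edges G. e \<subseteq> verts G \<and> card e = 2)"

definition subgraph_of :: "'a graph \<Rightarrow> 'a graph \<Rightarrow> bool" where
  "subgraph_of H G \<longleftrightarrow> verts H \<subseteq> verts G \<and> edges H \<subseteq> edges G"

definition induced_subgraph :: "'a graph \<Rightarrow> 'a set \<Rightarrow> 'a graph" where
  "induced_subgraph G S = Graph (verts G \<inter> S) {e \<in> edges G. e \<subseteq> S}"

definition complete_graph :: "'a set \<Rightarrow> 'a graph" where
  "complete_graph S = Graph S {e. e \<subseteq> S \<and> card e = 2}"

definition is_clique :: "'a graph \<Rightarrow> nat \<Rightarrow> 'a set \<Rightarrow> bool" where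
  "is_clique G k K \<longleftrightarrow> K \<subseteq> verts G \<and> finite K \<and> card K = k \<and>
     (\<forall>u\<in>K. \<forall>v\<in>K. u \<noteq> v \<longrightarrow> {u, v} \<in> edges G)"

(* The third argument records the k-cliques onto which a vertex has already been added. *)
inductive simple_ktree_construction :: "nat \<Rightarrow> 'a graph \<Rightarrow> 'a set set \<Rightarrow> bool" for k :: nat where
  start: "finite K \<Longrightarrow> card K = k + 1 \<Longrightarrow> simple_ktree_construction k (complete_graph K) {}"
| add_vertex: "simple_ktree_construction k G U \<Longrightarrow> is_clique G k K \<Longrightarrow> K \<notin> U \<Longrightarrow> v \<notin> verts G \<Longrightarrow>
    simple_ktree_construction k
      (Graph (insert v (verts G)) (edges G \<union> {{v, u} | u. u \<in> K})) (insert K U)"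

definition simple_ktree :: "nat \<Rightarrow> 'a graph \<Rightarrow> bool" where
  "simple_ktree k T \<longleftrightarrow> (\<exists>U. simple_ktree_construction k T U)"

(* Vertices are natural numbers so that a host graph may have arbitrarily many further vertices.
   The minimum is attained: a graph with n > 0 vertices lies in the simple (n-1)-tree on them. *)
definition stw :: "nat graph \<Rightarrow> nat" where
  "stw G = (LEAST k. \<exists>T. simple_ktree k T \<and> subgraph_of G T)"

definition connected_graph :: "'a graph \<Rightarrow> bool" where
  "connected_graph G \<longleftrightarrow> verts G \<noteq> {} \<and>
     (\<forall>u\<in>verts G. \<forall>v\<in>verts G. (u, v) \<in> {(x, y). {x, y} \<in> edges G}\<^sup>*)"

definition is_cycle :: "'a graph \<Rightarrow> 'a list \<Rightarrow> bool" where
  "is_cycle G xs \<longleftrightarrow> 3 \<le> length xs \<and> distinct xs \<and>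
     (\<forall>i. Suc i < length xs \<longrightarrow> {xs ! i, xs ! Suc i} \<in> edges G) \<and> {last xs, hd xs} \<in> edges G"

definition is_tree :: "'a graph \<Rightarrow> bool" where
  "is_tree G \<longleftrightarrow> simple_graph G \<and> connected_graph G \<and> (\<nexists>xs. is_cycle G xs)"

definition vdegree :: "'a graph \<Rightarrow> 'a \<Rightarrow> nat" where
  "vdegree G v = card {e \<in> edges G. v \<in> e}"

definition leaf :: "'a graph \<Rightarrow> 'a \<Rightarrow> bool" where
  "leaf G v \<longleftrightarrow> v \<in> verts G \<and> vdegree G v = 1"

(* The empty list is allowed, so that the single edge, all of whose vertices are leaves,
   is a caterpillar. *)
definition path_graph :: "'a graph \<Rightarrow> bool" where
  "path_graph G \<longleftrightarrow> (\<exists>xs. distinct xs \<and> verts G = set xs \<and>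
     edges G = {{xs ! i, xs ! Suc i} | i. Suc i < length xs})"

definition caterpillar :: "'a graph \<Rightarrow> bool" where
  "caterpillar G \<longleftrightarrow> is_tree G \<and> path_graph (induced_subgraph G {v \<in> verts G. \<not> leaf G v})"

definition caterpillar_forest :: "'a graph \<Rightarrow> bool" where
  "caterpillar_forest F \<longleftrightarrow> (\<exists>\<C>. finite \<C> \<and> (\<forall>C\<in>\<C>. caterpillar C) \<and>
     (\<forall>C\<in>\<C>. \<forall>D\<in>\<C>. C \<noteq> D \<longrightarrow> verts C \<inter> verts D = {}) \<and>
     verts F = (\<Union>C\<in>\<C>. verts C) \<and> edges F = (\<Union>C\<in>\<C>. edges C))"

definition graph_hom :: "('a \<Rightarrow> 'b) \<Rightarrow> 'a graph \<Rightarrow> 'b graph \<Rightarrow> bool" where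
  "graph_hom \<phi> F G \<longleftrightarrow> \<phi> ` verts F \<subseteq> verts G \<and> (\<forall>e\<in>edges F. \<phi> ` e \<in> edges G)"

definition edge_surjective :: "('a \<Rightarrow> 'b) \<Rightarrow> 'a graph \<Rightarrow> 'b graph \<Rightarrow> bool" where
  "edge_surjective \<phi> F G \<longleftrightarrow> (\<forall>e\<in>edges G. \<exists>f\<in>edges F. \<phi> ` f = e)"

(* Inserting 0 affects only the graph without vertices, where Max would be unspecified. *)
definition max_fibre :: "('a \<Rightarrow> 'b) \<Rightarrow> 'a graph \<Rightarrow> 'b graph \<Rightarrow> nat" where
  "max_fibre \<phi> F G = Max (insert 0 ((\<lambda>v. card {x \<in> verts F. \<phi> x = v}) ` verts G))"

(* Up to isomorphism every finite forest has natural numbers as vertices.  The minimum is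
   attained: a disjoint union of single edges, one for each edge of G, maps onto G. *)
definition ca_f :: "'a graph \<Rightarrow> nat" where
  "ca_f G = (LEAST n. \<exists>(F :: nat graph) \<phi>. caterpillar_forest F \<and> graph_hom \<phi> F G \<and>
     edge_surjective \<phi> F G \<and> n = max_fibre \<phi> F G)"

end

theory Submission
  imports Defs
begin

text \<open>A simple \<open>k\<close>-tree with \<open>n\<close> vertices has \<open>k n - O(1)\<close> edges, whereas a caterpillar forest
  with fibres of size at most \<open>k\<close> has at most \<open>k n\<close> vertices, hence at most \<open>k n\<close> edges minus its
  number of components.  So such a cover has boundedly many components and wastes almost nothing.
  In particular, if \<open>N\<close> independent vertices \<open>v\<close> of degree \<open>k\<close> are stacked onto a \<open>k\<close>-tree, all but
  boundedly many of them are covered by \<open>k\<close> copies of degree one.  Stack one further vertex \<open>w\<close> onto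
  a \<open>k\<close>-clique containing \<open>v\<close>, for each \<open>v\<close>.  For almost all pairs the copies of \<open>w\<close> are leaves, so
  a copy of \<open>v\<close> adjacent to a copy of \<open>w\<close> is an inner vertex with at most one inner neighbour, that
  is, an end of a spine.  There are at most two of these per component, which bounds \<open>N\<close>.\<close>

section \<open>Caterpillars: an injective choice of an end for every edge, and the ends of the
  spine\<close>

lemma edge_pairE:
  assumes "card e = 2" "x \<in> e"
  obtains y where "e = {x, y}" "x \<noteq> y"
proof -
  obtain a b where "e = {a, b}" "a \<noteq> b" using assms(1) by (auto simp: card_2_iff)
  then show ?thesis using assms(2) that[of a] that[of b] by (auto simp: insert_commute)
qed

lemma caterpillar_spine:
  assumes "caterpillar C"
  obtains xs where "distinct xs" "set xs = {v \<in> verts C. \<not> leaf C v}"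
    "{e \<in> edges C. e \<subseteq> {v \<in> verts C. \<not> leaf C v}} = {{xs ! i, xs ! Suc i} | i. Suc i < length xs}"
proof -
  let ?S = "{v \<in> verts C. \<not> leaf C v}"
  have "\<exists>xs. distinct xs \<and> verts C \<inter> ?S = set xs \<and>
      {e \<in> edges C. e \<subseteq> ?S} = {{xs ! i, xs ! Suc i} | i. Suc i < length xs}"
    using assms unfolding caterpillar_def path_graph_def induced_subgraph_def graph.sel by (elim conjE)
  then obtain xs where xs: "distinct xs \<and> verts C \<inter> ?S = set xs \<and>
      {e \<in> edges C. e \<subseteq> ?S} = {{xs ! i, xs ! Suc i} | i. Suc i < length xs}" ..
  have "verts C \<inter> ?S = ?S" by auto
  then have S: "set xs = ?S" using xs by simp
  have D: "distinct xs" using xs by simp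
  have "{e \<in> edges C. e \<subseteq> ?S} = {{xs ! i, xs ! Suc i} | i. Suc i < length xs}"
    using xs by (elim conjE)
  then show ?thesis by (rule that[OF D S])
qed

lemma caterpillar_simple:
  assumes "caterpillar C"
  shows "finite (verts C)" "e \<in> edges C \<Longrightarrow> e \<subseteq> verts C" "e \<in> edges C \<Longrightarrow> card e = 2"
    "verts C \<noteq> {}" "finite (edges C)"
proof -
  show *: "finite (verts C)" "e \<in> edges C \<Longrightarrow> e \<subseteq> verts C" "e \<in> edges C \<Longrightarrow> card e = 2"
    "verts C \<noteq> {}" for e
    using assms by (auto simp: caterpillar_def is_tree_def simple_graph_def connected_graph_def)
  show "finite (edges C)"
    by (rule finite_subset[of _ "Pow (verts C)"]) (use * in auto)
qed

lemma leaf_unique_edge: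
  assumes "leaf G v" "e \<in> edges G" "f \<in> edges G" "v \<in> e" "v \<in> f"
  shows "e = f"
proof -
  have "card {e \<in> edges G. v \<in> e} = 1"
    using assms(1) by (simp add: leaf_def vdegree_def)
  then obtain g where g: "{e \<in> edges G. v \<in> e} = {g}"
    by (auto simp: card_1_singleton_iff)
  have "e \<in> {e \<in> edges G. v \<in> e}" "f \<in> {e \<in> edges G. v \<in> e}" using assms by simp_all
  then show ?thesis unfolding g by simp
qed

text \<open>Rooting at the first spine vertex, every edge points to a vertex that no other edge
  points to: a leaf if it has one, and otherwise the later of two consecutive spine vertices. This
  is the bound "fewer edges than vertices" in a form that can be restricted to subsets of the edges
  and later combined over components.\<close>

lemma caterpillar_child_map:
  assumes C: "caterpillar C"
  obtains ch r where "r \<in> verts C" "inj_on ch (edges C)"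
    "\<And>e. e \<in> edges C \<Longrightarrow> ch e \<in> e \<and> ch e \<noteq> r"
proof -
  obtain xs where xs: "distinct xs" "set xs = {v \<in> verts C. \<not> leaf C v}"
    "{e \<in> edges C. e \<subseteq> {v \<in> verts C. \<not> leaf C v}} = {{xs ! i, xs ! Suc i} | i. Suc i < length xs}"
    using caterpillar_spine[OF C] .
  \<comment> \<open>The two alternatives exclude each other, since spine vertices are not leaves. An
    edge without a leaf end joins consecutive spine vertices, so one of them always applies.\<close>
  define P where "P e c \<longleftrightarrow> c \<in> e \<and> (leaf C c \<or>
    (\<exists>i. Suc i < length xs \<and> e = {xs ! i, xs ! Suc i} \<and> c = xs ! Suc i))" for e c
  have "\<exists>c. P e c" if e: "e \<in> edges C" for e
  proof (cases "\<exists>c\<in>e. leaf C c")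
    case True
    then show ?thesis by (auto simp: P_def)
  next
    case False
    then have "e \<in> {e \<in> edges C. e \<subseteq> {v \<in> verts C. \<not> leaf C v}}"
      using caterpillar_simple(2)[OF C e] e by auto
    then obtain i where "Suc i < length xs" "e = {xs ! i, xs ! Suc i}"
      unfolding xs(3) by auto
    then show ?thesis by (auto simp: P_def)
  qed
  then obtain ch where ch: "\<And>e. e \<in> edges C \<Longrightarrow> P e (ch e)" by metis
  have nonleaf: "\<not> leaf C (xs ! i)" if "i < length xs" for i
    using nth_mem[OF that] xs(2) by auto
  have inj: "inj_on ch (edges C)"
  proof (rule inj_onI)
    fix e f assume ef: "e \<in> edges C" "f \<in> edges C" "ch e = ch f"
    show "e = f"
    \<comment> \<open>A leaf lies on only one edge; a spine vertex chosen as
      \<open>xs ! Suc i\<close> determines \<open>i\<close>, because \<open>xs\<close> is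
      distinct.\<close>
    proof (cases "leaf C (ch e)")
      case True
      have "ch e \<in> e" "ch e \<in> f"
        using ch[OF ef(1)] ch[OF ef(2)] ef(3) by (simp_all add: P_def)
      then show ?thesis using leaf_unique_edge[OF True ef(1,2)] by simp
    next
      case False
      obtain i where i: "Suc i < length xs" "e = {xs ! i, xs ! Suc i}" "ch e = xs ! Suc i"
        using ch[OF ef(1)] False unfolding P_def by blast
      obtain j where j: "Suc j < length xs" "f = {xs ! j, xs ! Suc j}" "ch f = xs ! Suc j"
        using ch[OF ef(2)] False ef(3) unfolding P_def by metis
      have "i = j" using i(1,3) j(1,3) ef(3) xs(1) by (simp add: nth_eq_iff_index_eq)
      then show ?thesis using i(2) j(2) by simp
    qed
  qed
  have "\<exists>r\<in>verts C. \<forall>e\<in>edges C. ch e \<noteq> r"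
  proof (cases "xs = []")
    case False
    then have "xs ! 0 \<in> verts C" using xs(2) nth_mem[of 0 xs] by auto
    \<comment> \<open>The first spine vertex is neither a leaf nor the successor of a spine
      vertex.\<close>
    moreover have "ch e \<noteq> xs ! 0" if e: "e \<in> edges C" for e
    proof
      assume "ch e = xs ! 0"
      then obtain i where "Suc i < length xs" "xs ! 0 = xs ! Suc i"
        using ch[OF e] False nonleaf[of 0] unfolding P_def by auto
      moreover from this have "0 < length xs" by linarith
      ultimately show False using nth_eq_iff_index_eq[OF xs(1), of 0 "Suc i"] by simp
    qed
    ultimately show ?thesis by blast
  next
    case True
    then have leafs: "leaf C v" if "v \<in> verts C" for v using xs(2) that by auto
    \<comment> \<open>Without a spine all vertices are leaves. The root is then the end of some edge
      \<open>e\<close> that \<open>ch\<close> does not choose for \<open>e\<close>; being a leaf, it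
      lies on no other edge that could choose it.\<close>
    obtain v where v: "v \<in> verts C" using caterpillar_simple(4)[OF C] by auto
    have "{e \<in> edges C. v \<in> e} \<noteq> {}"
      using leafs[OF v] unfolding leaf_def vdegree_def by (metis card.empty zero_neq_one)
    then obtain e where e: "e \<in> edges C" "v \<in> e" by auto
    obtain r where r: "e = {ch e, r}" "r \<noteq> ch e"
      using edge_pairE[OF caterpillar_simple(3)[OF C e(1)], of "ch e"] ch[OF e(1)]
      unfolding P_def by metis
    then have "r \<in> verts C" "r \<in> e" using caterpillar_simple(2)[OF C e(1)] by auto
    moreover have "ch f \<noteq> r" if "f \<in> edges C" for f
    proof
      assume "ch f = r"
      then have "r \<in> f" using ch[OF that] by (simp add: P_def)
      then have "f = e"
        using leaf_unique_edge[OF leafs[OF \<open>r \<in> verts C\<close>] that e(1)] \<open>r \<in> e\<close> by simp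
      then show False using r(2) \<open>ch f = r\<close> by simp
    qed
    ultimately show ?thesis by blast
  qed
  then obtain r where "r \<in> verts C" "\<forall>e\<in>edges C. ch e \<noteq> r" by blast
  then show ?thesis using that[of r ch] inj ch by (simp add: P_def)
qed

text \<open>For a caterpillar these are the ends of its spine, the vertex of a one-vertex spine
  included. Only edges and leaves are mentioned, not a listing of the spine, so that the notion
  passes from a forest to its components.\<close>

definition spine_ends :: "'a graph \<Rightarrow> 'a set" where
  "spine_ends G = {x \<in> verts G. \<not> leaf G x \<and>
     (\<forall>y z. {x, y} \<in> edges G \<longrightarrow> {x, z} \<in> edges G \<longrightarrow> \<not> leaf G y \<longrightarrow> \<not> leaf G z \<longrightarrow> y = z)}"

text \<open>A spine vertex with both a predecessor and a successor has two distinct inner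
  neighbours, so only the first and the last one can qualify.\<close>

lemma caterpillar_spine_ends:
  assumes C: "caterpillar C"
  shows "card (spine_ends C) \<le> 2"
proof -
  obtain xs where xs: "distinct xs" "set xs = {v \<in> verts C. \<not> leaf C v}"
    "{e \<in> edges C. e \<subseteq> {v \<in> verts C. \<not> leaf C v}} = {{xs ! i, xs ! Suc i} | i. Suc i < length xs}"
    using caterpillar_spine[OF C] .
  have edge: "{xs ! i, xs ! Suc i} \<in> edges C" if "Suc i < length xs" for i
    using xs(3) that by blast
  have nonleaf: "\<not> leaf C (xs ! i)" if "i < length xs" for i
    using nth_mem[OF that] xs(2) by auto
  have "spine_ends C \<subseteq> {xs ! 0, xs ! (length xs - 1)}"
  proof
    fix x assume x: "x \<in> spine_ends C"
    then have "x \<in> set xs" by (simp add: xs(2) spine_ends_def)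
    then obtain i where i: "i < length xs" "x = xs ! i" by (auto simp: in_set_conv_nth)
    show "x \<in> {xs ! 0, xs ! (length xs - 1)}"
    proof (rule ccontr)
      assume "x \<notin> {xs ! 0, xs ! (length xs - 1)}"
      then have "x \<noteq> xs ! 0" "x \<noteq> xs ! (length xs - 1)" by simp_all
      then have "i \<noteq> 0" "i \<noteq> length xs - 1" using i(2) by metis+
      then have "i = Suc (i - 1)" "Suc i < length xs" using i(1) by linarith+
      then obtain j where j: "i = Suc j" "Suc i < length xs" by blast
      have "xs ! j = xs ! Suc i"
      proof -
        have "{x, xs ! j} \<in> edges C" "{x, xs ! Suc i} \<in> edges C"
          using edge[of j] edge[of i] i j by (auto simp: insert_commute)
        moreover have "\<not> leaf C (xs ! j)" "\<not> leaf C (xs ! Suc i)"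
          using nonleaf j by simp_all
        ultimately show ?thesis using x by (simp add: spine_ends_def)
      qed
      then show False using xs(1) j by (simp add: nth_eq_iff_index_eq)
    qed
  qed
  then have "card (spine_ends C) \<le> card {xs ! 0, xs ! (length xs - 1)}"
    by (intro card_mono) auto
  also have "\<dots> \<le> 2" by (simp add: card_insert_if)
  finally show ?thesis .
qed

text \<open>The child maps of the components are glued together, and \<open>R\<close> collects their
  roots. Thus \<open>card R\<close> is the number of components, each of which contributes at most
  two spine ends.\<close>

lemma caterpillar_forest_child_map:
  assumes F: "caterpillar_forest F"
  obtains ch R where "simple_graph F" "R \<subseteq> verts F" "inj_on ch (edges F)"
    "\<And>e. e \<in> edges F \<Longrightarrow> ch e \<in> e \<and> ch e \<notin> R" "card (spine_ends F) \<le> 2 * card R"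
proof -
  obtain \<C> where "finite \<C> \<and> (\<forall>C\<in>\<C>. caterpillar C) \<and>
     (\<forall>C\<in>\<C>. \<forall>D\<in>\<C>. C \<noteq> D \<longrightarrow> verts C \<inter> verts D = {}) \<and>
     verts F = (\<Union>C\<in>\<C>. verts C) \<and> edges F = (\<Union>C\<in>\<C>. edges C)"
    using F[unfolded caterpillar_forest_def] ..
  then have fin: "finite \<C>" and cat': "\<forall>C\<in>\<C>. caterpillar C"
    and disj: "\<forall>C\<in>\<C>. \<forall>D\<in>\<C>. C \<noteq> D \<longrightarrow> verts C \<inter> verts D = {}"
    and V: "verts F = (\<Union>C\<in>\<C>. verts C)" and E: "edges F = (\<Union>C\<in>\<C>. edges C)"
    by - (elim conjE, assumption)+
  note cat = bspec[OF cat']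
  note simp = caterpillar_simple[OF cat]
  have "simple_graph F"
    unfolding simple_graph_def
  proof (intro conjI ballI)
    show "finite (verts F)" unfolding V using fin simp(1) by (intro finite_UN_I)
    fix e assume "e \<in> edges F"
    then obtain C where C: "C \<in> \<C>" "e \<in> edges C" unfolding E ..
    show "e \<subseteq> verts F" using simp(2)[OF C] C(1) by (auto simp: V)
    show "card e = 2" using simp(3)[OF C] .
  qed
  have same: "C = D" if "C \<in> \<C>" "D \<in> \<C>" "x \<in> verts C" "x \<in> verts D" for C D x
    using disj[rule_format, OF that(1,2)] that(3,4) by blast
  \<comment> \<open>Components are disjoint, so the edges at a vertex, and with them the property of
    being a leaf, are the same in the forest as in its component.\<close>
  have local_edge: "e \<in> edges F \<longleftrightarrow> e \<in> edges C" if "C \<in> \<C>" "x \<in> verts C" "x \<in> e" for C x e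
  proof
    assume "e \<in> edges F"
    then obtain D where D: "D \<in> \<C>" "e \<in> edges D" unfolding E ..
    then have "D = C" using same[OF D(1) that(1), of x] that simp(2)[OF D] by auto
    then show "e \<in> edges C" using D by simp
  qed (use that in \<open>auto simp: E\<close>)
  have local_leaf: "leaf F x \<longleftrightarrow> leaf C x" if "C \<in> \<C>" "x \<in> verts C" for C x
  proof -
    have "{e \<in> edges F. x \<in> e} = {e \<in> edges C. x \<in> e}" using local_edge[OF that] by auto
    then show ?thesis using that by (auto simp: leaf_def vdegree_def V)
  qed
  have "\<exists>ch r. r \<in> verts C \<and> inj_on ch (edges C) \<and> (\<forall>e\<in>edges C. ch e \<in> e \<and> ch e \<noteq> r)"
    if "C \<in> \<C>" for C
    by (rule caterpillar_child_map[OF cat[OF that]]) blast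
  then obtain ch r where ch: "\<And>C. C \<in> \<C> \<Longrightarrow> r C \<in> verts C \<and> inj_on (ch C) (edges C) \<and>
      (\<forall>e\<in>edges C. ch C e \<in> e \<and> ch C e \<noteq> r C)" by metis
  obtain comp where comp: "\<And>e. e \<in> edges F \<Longrightarrow> comp e \<in> \<C> \<and> e \<in> edges (comp e)"
    unfolding E by (metis UN_E)
  define ch' where "ch' e = ch (comp e) e" for e
  have ch'_in: "ch' e \<in> e" "ch' e \<in> verts (comp e)" "ch' e \<noteq> r (comp e)" if "e \<in> edges F" for e
  proof -
    have c: "comp e \<in> \<C>" "e \<in> edges (comp e)" using comp[OF that] by simp_all
    then show "ch' e \<in> e" "ch' e \<noteq> r (comp e)" using ch[OF c(1)] unfolding ch'_def by simp_all
    then show "ch' e \<in> verts (comp e)" using simp(2)[OF c] by (rule_tac subsetD)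
  qed
  have inj: "inj_on ch' (edges F)"
  proof (rule inj_onI)
    fix e f assume ef: "e \<in> edges F" "f \<in> edges F" "ch' e = ch' f"
    have eq: "comp e = comp f"
    proof (rule same)
      show "ch' e \<in> verts (comp e)" "ch' e \<in> verts (comp f)"
        using ch'_in(2)[OF ef(1)] ch'_in(2)[OF ef(2)] ef(3) by simp_all
    qed (use comp ef in simp_all)
    have "inj_on (ch (comp e)) (edges (comp e))" using ch comp[OF ef(1)] by simp
    then show "e = f"
    proof (rule inj_onD)
      show "ch (comp e) e = ch (comp e) f" using ef(3) eq by (simp add: ch'_def)
      show "e \<in> edges (comp e)" "f \<in> edges (comp e)"
        using comp[OF ef(1)] comp[OF ef(2)] eq by simp_all
    qed
  qed
  have notin: "ch' e \<notin> r ` \<C>" if e: "e \<in> edges F" for e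
  proof
    assume "ch' e \<in> r ` \<C>"
    then obtain C where C: "C \<in> \<C>" "ch' e = r C" by auto
    have "C = comp e"
    proof (rule same)
      show "r C \<in> verts C" "r C \<in> verts (comp e)"
        using ch[OF C(1)] ch'_in(2)[OF e] C(2) by simp_all
    qed (use comp[OF e] C in simp_all)
    then show False using C ch'_in(3)[OF e] by simp
  qed
  have "inj_on r \<C>"
  proof (rule inj_onI)
    fix C D assume "C \<in> \<C>" "D \<in> \<C>" "r C = r D"
    then show "C = D" using same[of C D "r C"] ch[of C] ch[of D] by simp
  qed
  then have cardR: "card (r ` \<C>) = card \<C>" by (rule card_image)
  have "spine_ends F \<subseteq> (\<Union>C\<in>\<C>. spine_ends C)"
  proof
    fix x assume x: "x \<in> spine_ends F"
    then obtain C where C: "C \<in> \<C>" "x \<in> verts C" by (auto simp: spine_ends_def V)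
    have "x \<in> spine_ends C"
      unfolding spine_ends_def
    proof (intro CollectI conjI allI impI)
      show "x \<in> verts C" "\<not> leaf C x" using x C local_leaf by (auto simp: spine_ends_def)
      fix y z assume yz: "{x, y} \<in> edges C" "{x, z} \<in> edges C" "\<not> leaf C y" "\<not> leaf C z"
      then have "y \<in> verts C" "z \<in> verts C" using simp(2)[OF C(1)] by auto
      then have "\<not> leaf F y" "\<not> leaf F z" using yz local_leaf[OF C(1)] by auto
      moreover have "{x, y} \<in> edges F" "{x, z} \<in> edges F" using yz C(1) by (auto simp: E)
      ultimately show "y = z" using x by (simp add: spine_ends_def)
    qed
    then show "x \<in> (\<Union>C\<in>\<C>. spine_ends C)" using C by blast
  qed
  then have "card (spine_ends F) \<le> card (\<Union>C\<in>\<C>. spine_ends C)"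
    using fin simp(1) by (intro card_mono) (auto simp: spine_ends_def)
  also have "\<dots> \<le> (\<Sum>C\<in>\<C>. card (spine_ends C))" by (rule card_UN_le[OF fin])
  also have "\<dots> \<le> (\<Sum>C\<in>\<C>. 2)" by (intro sum_mono caterpillar_spine_ends cat)
  finally have "card (spine_ends F) \<le> 2 * card (r ` \<C>)" by (simp add: cardR)
  moreover have "r ` \<C> \<subseteq> verts F" unfolding V using ch by (auto intro!: UN_I)
  ultimately show ?thesis
    using \<open>simple_graph F\<close> inj notin ch'_in(1) by (intro that[of "r ` \<C>" ch']) auto
qed

section \<open>Counting in a cover whose fibres have size at most \<open>k\<close>\<close>

text \<open>Equal cardinalities make \<open>\<phi>\<close> injective on \<open>e\<close>. Hence
  counting the edges over \<open>b\<close> by their ends over \<open>b\<close> counts each edge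
  once.\<close>

lemma hom_fibre_unique:
  assumes "card e = 2" "card (\<phi> ` e) = 2" "b \<in> \<phi> ` e"
  shows "\<exists>!x. x \<in> e \<and> \<phi> x = b"
proof -
  obtain x where x: "x \<in> e" "\<phi> x = b" using assms(3) by auto
  have "inj_on \<phi> e" using assms(1,2) by (intro eq_card_imp_inj_on) (auto intro: card_ge_0_finite)
  then show ?thesis using x by (metis inj_onD)
qed

text \<open>The excesses \<open>f x - 1\<close> add up to 0.\<close>

lemma all_one_if_sum_eq_card:
  fixes f :: "'a \<Rightarrow> nat"
  assumes "finite A" "sum f A \<le> card A" "\<And>x. x \<in> A \<Longrightarrow> 1 \<le> f x" "a \<in> A"
  shows "f a = 1"
proof -
  have "card A + (\<Sum>x\<in>A. f x - 1) = (\<Sum>x\<in>A. 1 + (f x - 1))"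
    by (simp only: sum.distrib card_eq_sum)
  also have "\<dots> = sum f A" by (intro sum.cong refl le_add_diff_inverse assms(3))
  finally have "(\<Sum>x\<in>A. f x - 1) = 0" using assms(2) by simp
  then have "f a - 1 = 0" using assms(1,4) by simp
  then show ?thesis using assms(3)[OF assms(4)] by simp
qed

text \<open>The child map sends the edges over \<open>A \<union> B\<close> to distinct vertex copies and misses the
  isolated ones, so there are at most \<open>c\<close> vertices in \<open>B\<close> with a surplus edge or an isolated copy.\<close>
lemma few_bad_in_layer:
  fixes F :: "'b graph" and G :: "'a graph"
  assumes G: "simple_graph G" and F: "simple_graph F"
    and ch: "inj_on ch (edges F)" "\<And>e. e \<in> edges F \<Longrightarrow> ch e \<in> e"
    and hom: "graph_hom \<phi> F G" "edge_surjective \<phi> F G"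
    and fibre: "\<And>v. v \<in> verts G \<Longrightarrow> card {x \<in> verts F. \<phi> x = v} \<le> k"
    and AB: "A \<subseteq> verts G" "B \<subseteq> verts G" "A \<inter> B = {}"
    and indep: "\<And>b b'. b \<in> B \<Longrightarrow> b' \<in> B \<Longrightarrow> {b, b'} \<notin> edges G"
    and deg: "\<And>b. b \<in> B \<Longrightarrow> k \<le> card {e \<in> edges G. e \<subseteq> A \<union> B \<and> b \<in> e}"
    and dense: "k * card A \<le> card {e \<in> edges G. e \<subseteq> A} + c"
  shows "card {b \<in> B. \<not> (\<forall>x\<in>verts F. \<phi> x = b \<longrightarrow>
    card {e \<in> edges F. x \<in> e \<and> \<phi> ` e \<subseteq> A \<union> B} = 1)} \<le> c"
    (is "card {b \<in> B. \<not> ?good b} \<le> c")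
proof -
  have finV: "finite (verts F)" and finE: "finite (edges F)"
    and eF: "\<And>e. e \<in> edges F \<Longrightarrow> e \<subseteq> verts F \<and> card e = 2"
    using F finite_subset[of "edges F" "Pow (verts F)"] unfolding simple_graph_def by auto
  have finA: "finite A" and finB: "finite B"
    using AB G finite_subset unfolding simple_graph_def by blast+
  have im: "\<phi> ` e \<in> edges G \<and> card (\<phi> ` e) = 2" if "e \<in> edges F" for e
    using hom(1) G that unfolding graph_hom_def simple_graph_def by auto
  \<comment> \<open>\<open>X v\<close> is the fibre of \<open>v\<close>, \<open>EA\<close> consists
    of the edges over \<open>A\<close>, \<open>EB b\<close> of the edges over
    \<open>A \<union> B\<close> that meet the fibre of \<open>b\<close>, and \<open>Iso b\<close> of
    the copies of \<open>b\<close> on none of these.\<close>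
  define X where "X v = {x \<in> verts F. \<phi> x = v}" for v
  define EA where "EA = {e \<in> edges F. \<phi> ` e \<subseteq> A}"
  define EB where "EB b = {e \<in> edges F. \<phi> ` e \<subseteq> A \<union> B \<and> b \<in> \<phi> ` e}" for b
  define Iso where "Iso b = {x \<in> X b. \<forall>e\<in>EB b. x \<notin> e}" for b
  have finX: "finite (X v)" for v using finV by (simp add: X_def)
  have finEA: "finite EA" and finEB: "finite (EB b)" for b using finE by (simp_all add: EA_def EB_def)
  have finIso: "finite (Iso b)" for b using finX by (simp add: Iso_def)
  have cardX: "card (X v) \<le> k" if "v \<in> verts G" for v using fibre[OF that] by (simp add: X_def)
  \<comment> \<open>Edge surjectivity turns lower bounds on edges of \<open>G\<close> into lower
    bounds on edges of \<open>F\<close>.\<close>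
  have lift: "card {e \<in> edges G. P e} \<le> card {e \<in> edges F. P (\<phi> ` e)}" for P
  proof (rule surj_card_le)
    show "finite {e \<in> edges F. P (\<phi> ` e)}" using finE by simp
    show "{e \<in> edges G. P e} \<subseteq> (`) \<phi> ` {e \<in> edges F. P (\<phi> ` e)}"
      using hom(2) unfolding edge_surjective_def by fastforce
  qed
  have cEA: "k * card A \<le> card EA + c" using dense lift[of "\<lambda>e. e \<subseteq> A"] by (simp add: EA_def)
  have cEB: "k \<le> card (EB b)" if "b \<in> B" for b
    using deg[OF that] lift[of "\<lambda>e. e \<subseteq> A \<union> B \<and> b \<in> e"] by (simp add: EB_def)
  \<comment> \<open>A common edge would map onto \<open>{b, b'}\<close>, which the independence of
    \<open>B\<close> rules out.\<close>
  have EB_disj: "EB b \<inter> EB b' = {}" if b: "b \<in> B" "b' \<in> B" "b \<noteq> b'" for b b'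
  proof (rule ccontr)
    assume "EB b \<inter> EB b' \<noteq> {}"
    then obtain e where e: "e \<in> edges F" "b \<in> \<phi> ` e" "b' \<in> \<phi> ` e" by (auto simp: EB_def)
    have "card (\<phi> ` e) = 2" using im[OF e(1)] by simp
    from edge_pairE[OF this e(2)] obtain y where "\<phi> ` e = {b, y}" .
    then have "\<phi> ` e = {b, b'}" using e(3) b(3) by auto
    then show False using indep[OF b(1,2)] im[OF e(1)] by simp
  qed
  have EA_disj: "EA \<inter> (\<Union>b\<in>B. EB b) = {}" using AB(3) by (auto simp: EA_def EB_def)
  \<comment> \<open>The child of an edge is an end of it, hence never an isolated copy.\<close>
  have disj: "ch ` (EA \<union> (\<Union>b\<in>B. EB b)) \<inter> (\<Union>b\<in>B. Iso b) = {}"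
  proof (rule ccontr)
    assume "ch ` (EA \<union> (\<Union>b\<in>B. EB b)) \<inter> (\<Union>b\<in>B. Iso b) \<noteq> {}"
    then obtain e b where e: "e \<in> EA \<union> (\<Union>b\<in>B. EB b)" and b: "b \<in> B" "ch e \<in> Iso b" by blast
    have e': "e \<in> edges F" "\<phi> ` e \<subseteq> A \<union> B" using e by (auto simp: EA_def EB_def)
    have "\<phi> (ch e) = b" using b(2) by (simp add: Iso_def X_def)
    then have "e \<in> EB b" using e' ch(2)[OF e'(1)] by (auto simp: EB_def)
    then show False using b(2) ch(2)[OF e'(1)] by (simp add: Iso_def)
  qed
  have sub: "ch ` (EA \<union> (\<Union>b\<in>B. EB b)) \<union> (\<Union>b\<in>B. Iso b) \<subseteq> (\<Union>v\<in>A \<union> B. X v)"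
  proof -
    have "ch e \<in> (\<Union>v\<in>A \<union> B. X v)" if "e \<in> EA \<union> (\<Union>b\<in>B. EB b)" for e
    proof -
      have e': "e \<in> edges F" "\<phi> ` e \<subseteq> A \<union> B" using that by (auto simp: EA_def EB_def)
      then show ?thesis using ch(2)[OF e'(1)] eF[OF e'(1)] by (auto simp: X_def)
    qed
    then show ?thesis by (auto simp: Iso_def)
  qed
  \<comment> \<open>Children and isolated copies are distinct vertices over
    \<open>A \<union> B\<close>. The fibres over \<open>A\<close> account for at most
    \<open>k * card A\<close> of these, while \<open>EA\<close> has at least
    \<open>k * card A - c\<close> edges, so over \<open>B\<close> the edges and isolated copies
    exceed the fibre sizes by at most \<open>c\<close> in total.\<close>
  have "card (ch ` (EA \<union> (\<Union>b\<in>B. EB b))) + card (\<Union>b\<in>B. Iso b) =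
      card (ch ` (EA \<union> (\<Union>b\<in>B. EB b)) \<union> (\<Union>b\<in>B. Iso b))"
    by (rule card_Un_disjoint[symmetric, OF _ _ disj]) (use finB finEA finEB finIso in simp_all)
  also have "\<dots> \<le> card (\<Union>v\<in>A \<union> B. X v)"
    by (rule card_mono[OF _ sub]) (use finA finB finX in simp)
  also have "\<dots> = (\<Sum>v\<in>A. card (X v)) + (\<Sum>b\<in>B. card (X b))"
  proof -
    have "card (\<Union>v\<in>A \<union> B. X v) = (\<Sum>v\<in>A \<union> B. card (X v))"
      using finA finB finX by (intro card_UN_disjoint) (auto simp: X_def)
    then show ?thesis using finA finB AB(3) by (simp add: sum.union_disjoint)
  qed
  also have "(\<Sum>v\<in>A. card (X v)) \<le> k * card A"
    using sum_bounded_above[of A "\<lambda>v. card (X v)" k] cardX AB(1) by (auto simp: mult.commute)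
  also have "card (ch ` (EA \<union> (\<Union>b\<in>B. EB b))) = card EA + (\<Sum>b\<in>B. card (EB b))"
  proof -
    have "card (ch ` (EA \<union> (\<Union>b\<in>B. EB b))) = card (EA \<union> (\<Union>b\<in>B. EB b))"
      by (intro card_image inj_on_subset[OF ch(1)]) (auto simp: EA_def EB_def)
    also have "\<dots> = card EA + card (\<Union>b\<in>B. EB b)"
      using EA_disj finEA finEB finB by (intro card_Un_disjoint) auto
    also have "card (\<Union>b\<in>B. EB b) = (\<Sum>b\<in>B. card (EB b))"
      using finEB finB EB_disj by (intro card_UN_disjoint) auto
    finally show ?thesis .
  qed
  also have "card (\<Union>b\<in>B. Iso b) = (\<Sum>b\<in>B. card (Iso b))"
    using finB finIso by (intro card_UN_disjoint) (auto simp: Iso_def X_def)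
  finally have "(\<Sum>b\<in>B. card (EB b) + card (Iso b)) \<le> c + (\<Sum>b\<in>B. card (X b))"
    using cEA by (simp add: sum.distrib)
  \<comment> \<open>No vertex of \<open>B\<close> contributes negatively to this excess, and each
    bad one contributes at least 1.\<close>
  moreover have "(\<Sum>b\<in>B. card (X b)) + card {b \<in> B. \<not> ?good b} \<le> (\<Sum>b\<in>B. card (EB b) + card (Iso b))"
  proof -
    have "(\<Sum>b\<in>B. card (X b)) + card {b \<in> B. \<not> ?good b} =
        (\<Sum>b\<in>B. card (X b) + (if \<not> ?good b then 1 else 0))"
      using finB by (simp add: sum.distrib sum.If_cases Int_def)
    also have "\<dots> \<le> (\<Sum>b\<in>B. card (EB b) + card (Iso b))"
    proof (rule sum_mono)
      fix b assume b: "b \<in> B"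
      have le: "card (X b) \<le> card (EB b)"
        using cardX[of b] cEB[OF b] b AB(2) by auto
      \<comment> \<open>With no excess at \<open>b\<close>, the fibre, \<open>k\<close> and
        \<open>EB b\<close> have equal size and no copy is isolated. The degrees of the copies are
        then positive and average 1, so all of them are 1.\<close>
      have good: "?good b" if tight: "card (EB b) + card (Iso b) \<le> card (X b)"
      proof (intro ballI impI)
        fix x assume x: "x \<in> verts F" "\<phi> x = b"
        let ?d = "\<lambda>x. card {e \<in> EB b. x \<in> e}"
        \<comment> \<open>Double counting of incident pairs: every edge of \<open>EB b\<close> has
          exactly one end over \<open>b\<close>.\<close>
        have "sum ?d (X b) = card (EB b)"
        proof -
          have "(\<Sum>x\<in>X b. ?d x) = card (SIGMA x:X b. {e \<in> EB b. x \<in> e})"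
            using finX finEB by (simp add: card_SigmaI)
          also have "\<dots> = card (EB b)"
          proof (rule bij_betw_same_card[of snd], rule bij_betwI')
            have ex1: "\<exists>!x. x \<in> e \<and> \<phi> x = b" if "e \<in> EB b" for e
              using that im eF by (intro hom_fibre_unique) (auto simp: EB_def)
            fix p assume p: "p \<in> (SIGMA x:X b. {e \<in> EB b. x \<in> e})"
            then show "snd p \<in> EB b" by auto
            fix q assume q: "q \<in> (SIGMA x:X b. {e \<in> EB b. x \<in> e})"
            show "snd p = snd q \<longleftrightarrow> p = q"
            proof
              assume eq: "snd p = snd q"
              have "fst p \<in> snd p" "\<phi> (fst p) = b" "snd p \<in> EB b" "fst q \<in> snd q" "\<phi> (fst q) = b"
                using p q by (auto simp: X_def)
              then have "fst p = fst q" using ex1[of "snd p"] eq by metis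
              then show "p = q" using eq by (simp add: prod_eq_iff)
            qed simp
          next
            fix e assume e: "e \<in> EB b"
            then obtain x where "x \<in> e" "\<phi> x = b" by (auto simp: EB_def)
            then have "(x, e) \<in> (SIGMA x:X b. {e \<in> EB b. x \<in> e})"
              using e eF by (auto simp: X_def EB_def)
            then show "\<exists>p\<in>SIGMA x:X b. {e \<in> EB b. x \<in> e}. e = snd p" by force
          qed
          finally show ?thesis .
        qed
        then have sum_le: "sum ?d (X b) \<le> card (X b)" using tight by simp
        have "card (Iso b) = 0" using tight le by linarith
        then have "Iso b = {}" using finIso by simp
        then have "{e \<in> EB b. y \<in> e} \<noteq> {}" if "y \<in> X b" for y
          using that by (auto simp: Iso_def)
        then have ge: "1 \<le> ?d y" if "y \<in> X b" for y
          using that finEB by (simp add: Suc_le_eq card_gt_0_iff)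
        have "?d x = 1"
          by (rule all_one_if_sum_eq_card[OF finX sum_le ge]) (use x in \<open>auto simp: X_def\<close>)
        moreover have "{e \<in> EB b. x \<in> e} = {e \<in> edges F. x \<in> e \<and> \<phi> ` e \<subseteq> A \<union> B}"
          using x by (auto simp: EB_def)
        ultimately show "card {e \<in> edges F. x \<in> e \<and> \<phi> ` e \<subseteq> A \<union> B} = 1" by simp
      qed
      show "card (X b) + (if \<not> ?good b then 1 else 0) \<le> card (EB b) + card (Iso b)"
      proof (cases "card (EB b) + card (Iso b) \<le> card (X b)")
        case True
        then show ?thesis using le good[OF True] by simp
      next
        case False
        then show ?thesis by simp
      qed
    qed
    finally show ?thesis .
  qed
  ultimately show ?thesis by linarith
qed

text \<open>\<open>w\<close> matches each vertex of \<open>V\<close> with its only neighbour in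
  \<open>W\<close>. At most \<open>c\<close> vertices of \<open>V\<close> are bad relative to
  \<open>P\<close>, at most \<open>c\<close> of \<open>W\<close> relative to
  \<open>P \<union> V\<close>, and every other \<open>v\<close> has a copy among the at most
  \<open>2 * c\<close> spine ends.\<close>

lemma cover_layer_bound:
  fixes F :: "'b graph" and G :: "'a graph"
  assumes G: "simple_graph G" and F: "caterpillar_forest F"
    and hom: "graph_hom \<phi> F G" "edge_surjective \<phi> F G"
    and fibre: "\<And>v. v \<in> verts G \<Longrightarrow> card {x \<in> verts F. \<phi> x = v} \<le> k"
    and layers: "verts G = P \<union> V \<union> W" "P \<inter> V = {}" "(P \<union> V) \<inter> W = {}"
    and indep: "\<And>b b'. b \<in> V \<Longrightarrow> b' \<in> V \<Longrightarrow> {b, b'} \<notin> edges G"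
      "\<And>b b'. b \<in> W \<Longrightarrow> b' \<in> W \<Longrightarrow> {b, b'} \<notin> edges G"
    and deg: "\<And>b. b \<in> V \<Longrightarrow> k \<le> card {e \<in> edges G. e \<subseteq> P \<union> V \<and> b \<in> e}"
      "\<And>b. b \<in> W \<Longrightarrow> k \<le> card {e \<in> edges G. e \<subseteq> P \<union> V \<union> W \<and> b \<in> e}"
    and dense: "k * card P \<le> card {e \<in> edges G. e \<subseteq> P} + c"
      "k * card (P \<union> V) \<le> card {e \<in> edges G. e \<subseteq> P \<union> V} + c"
      "k * card (verts G) \<le> card (edges G) + c"
    and w: "inj_on w V" "\<And>v. v \<in> V \<Longrightarrow> w v \<in> W \<and> {v, w v} \<in> edges G"
      "\<And>v u. v \<in> V \<Longrightarrow> u \<in> W \<Longrightarrow> {v, u} \<in> edges G \<Longrightarrow> u = w v"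
  shows "card V \<le> 4 * c"
proof -
  obtain ch R where F': "simple_graph F" and R: "R \<subseteq> verts F" and inj: "inj_on ch (edges F)"
    and ch: "\<And>e. e \<in> edges F \<Longrightarrow> ch e \<in> e \<and> ch e \<notin> R" and ends: "card (spine_ends F) \<le> 2 * card R"
    by (rule caterpillar_forest_child_map[OF F]) (rule that; assumption)
  have finV: "finite (verts F)" and finE: "finite (edges F)"
    and eF: "\<And>e. e \<in> edges F \<Longrightarrow> e \<subseteq> verts F \<and> card e = 2"
    using F' finite_subset[of "edges F" "Pow (verts F)"] unfolding simple_graph_def by auto
  have finG: "finite (verts G)" using G by (simp add: simple_graph_def)
  have hv: "\<phi> x \<in> verts G" if "x \<in> verts F" for x using hom(1) that by (auto simp: graph_hom_def)
  have he: "\<phi> ` e \<in> edges G" if "e \<in> edges F" for e using hom(1) that by (auto simp: graph_hom_def)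
  have he_sub: "\<phi> ` e \<subseteq> verts G" if "e \<in> edges F" for e using eF[OF that] hv by auto
  define gV where "gV b \<longleftrightarrow> (\<forall>x\<in>verts F. \<phi> x = b \<longrightarrow>
    card {e \<in> edges F. x \<in> e \<and> \<phi> ` e \<subseteq> P \<union> V} = 1)" for b
  define gW where "gW b \<longleftrightarrow> (\<forall>x\<in>verts F. \<phi> x = b \<longrightarrow>
    card {e \<in> edges F. x \<in> e \<and> \<phi> ` e \<subseteq> P \<union> V \<union> W} = 1)" for b
  have ch1: "ch e \<in> e" if "e \<in> edges F" for e using ch[OF that] by simp
  have badV: "card {b \<in> V. \<not> gV b} \<le> c"
    unfolding gV_def using G F' inj ch1 hom fibre _ _ layers(2) indep(1) deg(1) dense(1)
    by (rule few_bad_in_layer) (use layers(1) in auto)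
  have badW: "card {b \<in> W. \<not> gW b} \<le> c"
    unfolding gW_def using G F' inj ch1 hom fibre _ _ layers(3) indep(2) deg(2) dense(2)
    by (rule few_bad_in_layer) (use layers(1) in auto)
  \<comment> \<open>Roots are not children, so \<open>card (edges F) + card R\<close> is at most the
    number of vertices of \<open>F\<close>, which is at most \<open>k * card (verts G)\<close>. By
    density this is at most \<open>card (edges G) + c\<close>, and \<open>F\<close> has at least as
    many edges as \<open>G\<close>.\<close>
  have cardR: "card R \<le> c"
  proof -
    have "card (edges F) + card R = card (ch ` edges F) + card R" using card_image[OF inj] by simp
    also have "\<dots> = card (ch ` edges F \<union> R)"
      using finE finite_subset[OF R finV] ch by (intro card_Un_disjoint[symmetric]) auto
    also have "\<dots> \<le> card (\<Union>v\<in>verts G. {x \<in> verts F. \<phi> x = v})"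
    proof (rule card_mono)
      show "ch ` edges F \<union> R \<subseteq> (\<Union>v\<in>verts G. {x \<in> verts F. \<phi> x = v})"
      proof
        fix x assume "x \<in> ch ` edges F \<union> R"
        then have "x \<in> verts F" using R ch1 eF by auto
        then show "x \<in> (\<Union>v\<in>verts G. {x \<in> verts F. \<phi> x = v})" using hv by simp
      qed
    qed (use finG finV in simp)
    also have "\<dots> \<le> (\<Sum>v\<in>verts G. card {x \<in> verts F. \<phi> x = v})" by (rule card_UN_le[OF finG])
    also have "\<dots> \<le> k * card (verts G)"
      using sum_bounded_above[of "verts G" _ k] fibre by (simp add: mult.commute)
    also have "\<dots> \<le> card (edges G) + c" by (rule dense(3))
    also have "card (edges G) \<le> card (edges F)"
    proof (rule surj_card_le[OF finE])
      show "edges G \<subseteq> (`) \<phi> ` edges F"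
      proof
        fix e assume "e \<in> edges G"
        with hom(2)[unfolded edge_surjective_def] have "\<exists>f\<in>edges F. \<phi> ` f = e" by (rule bspec)
        then obtain f where "f \<in> edges F" "\<phi> ` f = e" ..
        then show "e \<in> (`) \<phi> ` edges F" by (intro image_eqI[of _ _ f]) simp_all
      qed
    qed
    finally show ?thesis by simp
  qed
  \<comment> \<open>A copy \<open>x\<close> of \<open>v\<close> on an edge \<open>f\<close> over
    \<open>{v, w v}\<close> also lies on one edge \<open>g\<close> over \<open>P \<union> V\<close>,
    so it is no leaf. All other edges at \<open>x\<close> lead to copies of \<open>w v\<close>,
    which are leaves; hence \<open>x\<close> has at most one inner neighbour.\<close>
  have end_over: "v \<in> \<phi> ` spine_ends F" if v: "v \<in> V" "gV v" "gW (w v)" for v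
  proof -
    have wv: "w v \<in> W" "{v, w v} \<in> edges G" using w(2)[OF v(1)] by simp_all
    have "\<exists>f\<in>edges F. \<phi> ` f = {v, w v}"
      using hom(2)[unfolded edge_surjective_def] wv(2) by (rule bspec)
    then obtain f where f: "f \<in> edges F" "\<phi> ` f = {v, w v}" ..
    have "v \<in> \<phi> ` f" by (simp add: f(2))
    then obtain x where x: "x \<in> f" "\<phi> x = v" by (elim imageE) simp
    have xF: "x \<in> verts F" using eF[OF f(1)] x(1) by auto
    have "card {e \<in> edges F. x \<in> e \<and> \<phi> ` e \<subseteq> P \<union> V} = 1"
      using v(2) xF x(2) unfolding gV_def by simp
    then obtain g where g: "{e \<in> edges F. x \<in> e \<and> \<phi> ` e \<subseteq> P \<union> V} = {g}"
      by (auto simp: card_1_singleton_iff)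
    have "g \<in> {e \<in> edges F. x \<in> e \<and> \<phi> ` e \<subseteq> P \<union> V}" unfolding g by simp
    then have g1: "g \<in> edges F" "x \<in> g" "\<phi> ` g \<subseteq> P \<union> V" by simp_all
    have "w v \<notin> P \<union> V" using wv(1) layers(3) by auto
    then have "f \<noteq> g" using f(2) g1(3) by auto
    have "\<not> leaf F x"
      using leaf_unique_edge[OF _ f(1) g1(1) x(1) g1(2)] \<open>f \<noteq> g\<close> by blast
    have inner_edge: "{x, y} = g" if y: "{x, y} \<in> edges F" "\<not> leaf F y" for y
    proof -
      have yF: "y \<in> verts F" using eF[OF y(1)] by auto
      have "\<phi> y \<notin> W"
      proof
        assume "\<phi> y \<in> W"
        moreover have "{v, \<phi> y} \<in> edges G" using he[OF y(1)] x(2) by simp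
        ultimately have "\<phi> y = w v" using w(3)[OF v(1)] by simp
        then have "card {e \<in> edges F. y \<in> e \<and> \<phi> ` e \<subseteq> P \<union> V \<union> W} = 1"
          using v(3) yF unfolding gW_def by simp
        \<comment> \<open>\<open>P\<close>, \<open>V\<close> and \<open>W\<close> exhaust the
          vertices of \<open>G\<close>, so goodness in \<open>W\<close> concerns the full
          degree.\<close>
        moreover have "{e \<in> edges F. y \<in> e \<and> \<phi> ` e \<subseteq> P \<union> V \<union> W} = {e \<in> edges F. y \<in> e}"
          unfolding layers(1)[symmetric] using he_sub by auto
        ultimately have "leaf F y" using yF by (simp add: leaf_def vdegree_def)
        then show False using y(2) by simp
      qed
      then have "\<phi> ` {x, y} \<subseteq> P \<union> V" using hv[OF yF] layers(1) x(2) v(1) by auto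
      then have "{x, y} \<in> {e \<in> edges F. x \<in> e \<and> \<phi> ` e \<subseteq> P \<union> V}" using y(1) by simp
      then show ?thesis unfolding g by simp
    qed
    have "x \<in> spine_ends F"
      unfolding spine_ends_def
    proof (intro CollectI conjI allI impI)
      fix y z assume yz: "{x, y} \<in> edges F" "{x, z} \<in> edges F" "\<not> leaf F y" "\<not> leaf F z"
      have "{x, y} = {x, z}" using inner_edge[OF yz(1,3)] inner_edge[OF yz(2,4)] by (rule trans[OF _ sym])
      then show "y = z" by (auto simp: doubleton_eq_iff)
    qed (use xF \<open>\<not> leaf F x\<close> in simp_all)
    then show ?thesis using x(2) by auto
  qed
  have finVW: "finite V" "finite W" using finG layers(1) by simp_all
  have "card V \<le> card ({b \<in> V. \<not> gV b} \<union> {b \<in> V. \<not> gW (w b)} \<union> \<phi> ` spine_ends F)"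
    using finVW finV end_over by (intro card_mono) (auto simp: spine_ends_def)
  also have "\<dots> \<le> card {b \<in> V. \<not> gV b} + card {b \<in> V. \<not> gW (w b)} + card (\<phi> ` spine_ends F)"
    by (rule order_trans[OF card_Un_le add_right_mono[OF card_Un_le]])
  also have "card {b \<in> V. \<not> gW (w b)} \<le> card {b \<in> W. \<not> gW b}"
  proof (rule card_inj_on_le)
    show "inj_on w {b \<in> V. \<not> gW (w b)}" by (rule inj_on_subset[OF w(1)]) auto
    show "w ` {b \<in> V. \<not> gW (w b)} \<subseteq> {b \<in> W. \<not> gW b}" using w(2) by auto
  qed (use finVW in simp)
  also have "card (\<phi> ` spine_ends F) \<le> card (spine_ends F)"
    using finV by (intro card_image_le) (simp add: spine_ends_def)
  finally show ?thesis using badV badW ends cardR by linarith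
qed

section \<open>Existence of an optimal cover\<close>

lemma edges_complete_graph_pair:
  assumes "a \<noteq> b"
  shows "edges (complete_graph {a, b}) = {{a, b}}"
proof
  show "edges (complete_graph {a, b}) \<subseteq> {{a, b}}"
  proof
    fix e assume "e \<in> edges (complete_graph {a, b})"
    then have "e \<subseteq> {a, b}" "card e = card {a, b}" using assms by (simp_all add: complete_graph_def)
    then have "e = {a, b}" by (intro card_subset_eq) simp_all
    then show "e \<in> {{a, b}}" by simp
  qed
qed (use assms in \<open>simp add: complete_graph_def\<close>)

text \<open>Both vertices are leaves, so the spine is the empty list. A cycle would need two
  consecutive edges with different far ends, but there is only one edge.\<close>

lemma caterpillar_single_edge:
  assumes "a \<noteq> b"
  shows "caterpillar (complete_graph {a, b})"
proof -
  note edges = edges_complete_graph_pair[OF assms]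
  have verts: "verts (complete_graph {a, b}) = {a, b}" by (simp add: complete_graph_def)
  have leaf: "leaf (complete_graph {a, b}) v" if "v \<in> {a, b}" for v
  proof -
    have "{e \<in> {{a, b}}. v \<in> e} = {{a, b}}" using that by auto
    then show ?thesis using that by (simp add: leaf_def vdegree_def edges verts)
  qed
  have "simple_graph (complete_graph {a, b})"
    using assms by (simp add: simple_graph_def edges verts)
  moreover have "connected_graph (complete_graph {a, b})"
    by (auto simp: connected_graph_def edges verts insert_commute intro!: r_into_rtrancl)
  moreover have "\<not> is_cycle (complete_graph {a, b}) xs" for xs
  proof
    assume "is_cycle (complete_graph {a, b}) xs"
    then have xs: "3 \<le> length xs" "distinct xs"
      "\<And>i. Suc i < length xs \<Longrightarrow> {xs ! i, xs ! Suc i} = {a, b}"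
      by (auto simp: is_cycle_def edges)
    have "{xs ! 0, xs ! 1} = {xs ! 1, xs ! 2}"
      using xs(3)[of 0] xs(3)[of 1] xs(1) by (simp add: numeral_2_eq_2)
    then have "xs ! 0 = xs ! 2" by (auto simp: doubleton_eq_iff)
    moreover have "0 < length xs" "2 < length xs" using xs(1) by linarith+
    ultimately show False using nth_eq_iff_index_eq[OF xs(2), of 0 2] by simp
  qed
  moreover have "path_graph (induced_subgraph (complete_graph {a, b})
      {v \<in> verts (complete_graph {a, b}). \<not> leaf (complete_graph {a, b}) v})"
  proof -
    have "{v \<in> verts (complete_graph {a, b}). \<not> leaf (complete_graph {a, b}) v} = {}"
      using leaf by (auto simp: verts)
    then show ?thesis
      by (auto simp: path_graph_def induced_subgraph_def edges intro!: exI[of _ "[]"])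
  qed
  ultimately show ?thesis by (simp add: caterpillar_def is_tree_def)
qed

text \<open>The \<open>LEAST\<close> in \<open>ca_f\<close> is a value of an actual cover once some
  cover exists. Disjoint single edges, one for each edge of \<open>G\<close>, provide one.\<close>

lemma ca_f_attained:
  fixes G :: "'a graph"
  assumes G: "simple_graph G"
  shows "\<exists>(F :: nat graph) \<phi>. caterpillar_forest F \<and> graph_hom \<phi> F G \<and>
    edge_surjective \<phi> F G \<and> ca_f G = max_fibre \<phi> F G"
proof -
  have eG: "e \<subseteq> verts G \<and> card e = 2" if "e \<in> edges G" for e
    using G that by (simp add: simple_graph_def)
  have "finite (edges G)"
    using G finite_subset[of "edges G" "Pow (verts G)"] by (auto simp: simple_graph_def)
  then obtain g where g: "bij_betw g {0..<card (edges G)} (edges G)"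
    using ex_bij_betw_nat_finite by blast
  define m where "m = card (edges G)"
  have gi: "g i \<in> edges G" if "i < m" for i using g that by (auto simp: bij_betw_def m_def)
  have "\<exists>a b. g i = {a, b}" if "i < m" for i
    using eG[OF gi[OF that]] by (auto simp: card_2_iff)
  then obtain a b where ab: "\<And>i. i < m \<Longrightarrow> g i = {a i, b i}" by metis
  \<comment> \<open>The \<open>i\<close>-th edge of \<open>G\<close> is covered by the edge on
    \<open>2 * i\<close> and \<open>2 * i + 1\<close>, so parity and half of a number recover the
    end and the edge.\<close>
  define \<C> where "\<C> = (\<lambda>i. complete_graph {2 * i, 2 * i + 1 :: nat}) ` {..<m}"
  define F where "F = Graph (\<Union>C\<in>\<C>. verts C) (\<Union>C\<in>\<C>. edges C)"
  define \<phi> where "\<phi> n = (if even n then a (n div 2) else b (n div 2))" for n :: nat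
  have "caterpillar_forest F"
    unfolding caterpillar_forest_def
  proof (intro exI[of _ \<C>] conjI ballI impI)
    fix C D assume "C \<in> \<C>" "D \<in> \<C>" "C \<noteq> D"
    then obtain i j where "C = complete_graph {2 * i, 2 * i + 1}" "D = complete_graph {2 * j, 2 * j + 1}"
      "i \<noteq> j" by (auto simp: \<C>_def)
    then show "verts C \<inter> verts D = {}" by (auto simp: complete_graph_def)
  next
    fix C assume "C \<in> \<C>"
    then obtain i where "C = complete_graph {2 * i, 2 * i + 1}" by (auto simp: \<C>_def)
    then show "caterpillar C" using caterpillar_single_edge[of "2 * i" "2 * i + 1"] by simp
  qed (simp_all add: \<C>_def F_def)
  moreover have edges: "edges F = (\<lambda>i. {2 * i, 2 * i + 1}) ` {..<m}"
  proof -
    have "edges (complete_graph {2 * i, 2 * i + 1}) = {{2 * i, 2 * i + 1}}" for i :: nat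
      by (rule edges_complete_graph_pair) simp
    then show ?thesis by (auto simp: F_def \<C>_def)
  qed
  have img: "\<phi> ` {2 * i, 2 * i + 1} = g i" if "i < m" for i
    using ab[OF that] by (simp add: \<phi>_def insert_commute)
  have "graph_hom \<phi> F G"
    unfolding graph_hom_def
  proof (intro conjI ballI)
    show "\<phi> ` verts F \<subseteq> verts G"
    proof
      fix v assume "v \<in> \<phi> ` verts F"
      then obtain i where "i < m" "v \<in> \<phi> ` {2 * i, 2 * i + 1}"
        by (auto simp: F_def \<C>_def complete_graph_def)
      then have "v \<in> g i" by (simp only: img)
      then show "v \<in> verts G" using eG[OF gi[OF \<open>i < m\<close>]] by auto
    qed
    fix e assume "e \<in> edges F"
    then obtain i where "i < m" "e = {2 * i, 2 * i + 1}" unfolding edges by auto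
    then show "\<phi> ` e \<in> edges G" using img[of i] gi[of i] by simp
  qed
  moreover have "edge_surjective \<phi> F G"
    unfolding edge_surjective_def
  proof
    fix e assume "e \<in> edges G"
    then have "e \<in> g ` {0..<m}" using bij_betw_imp_surj_on[OF g] by (simp add: m_def)
    then obtain i where "i < m" "e = g i" by auto
    then have "\<phi> ` {2 * i, 2 * i + 1} = e" "{2 * i, 2 * i + 1} \<in> edges F"
      using img[of i] unfolding edges by simp_all
    then show "\<exists>f\<in>edges F. \<phi> ` f = e" ..
  qed
  ultimately have "\<exists>n. \<exists>(F :: nat graph) \<phi>. caterpillar_forest F \<and> graph_hom \<phi> F G \<and>
      edge_surjective \<phi> F G \<and> n = max_fibre \<phi> F G" by blast
  from LeastI_ex[OF this] show ?thesis unfolding ca_f_def .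
qed

section \<open>Graphs on an initial segment of the naturals, given by the earlier neighbours of each
  vertex\<close>

definition back_graph :: "(nat \<Rightarrow> nat set) \<Rightarrow> nat \<Rightarrow> nat graph" where
  "back_graph B n = Graph {..<n} {{u, b} | u b. u \<in> B b \<and> b < n}"

locale back_neighbours =
  fixes B :: "nat \<Rightarrow> nat set"
  assumes below: "B b \<subseteq> {..<b}"
begin

lemma verts_back_graph [simp]: "verts (back_graph B n) = {..<n}"
  by (simp add: back_graph_def)

lemma edges_back_graph: "edges (back_graph B n) = {{u, b} | u b. u \<in> B b \<and> b < n}"
  by (simp add: back_graph_def)

lemma finite_back: "finite (B b)"
  using below finite_subset by blast

lemma edge_back_graph_iff:
  assumes "u < b"
  shows "{u, b} \<in> edges (back_graph B n) \<longleftrightarrow> u \<in> B b \<and> b < n"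
proof
  assume "{u, b} \<in> edges (back_graph B n)"
  then obtain u' b' where *: "{u, b} = {u', b'}" "u' \<in> B b'" "b' < n"
    by (auto simp: edges_back_graph)
  have "u' < b'" using below[of b'] *(2) by auto
  then have "u = u' \<and> b = b'" using *(1) assms by (auto simp: doubleton_eq_iff)
  then show "u \<in> B b \<and> b < n" using * by simp
qed (auto simp: edges_back_graph)

lemma edges_back_graph_Suc:
  "edges (back_graph B (Suc n)) = edges (back_graph B n) \<union> {{n, u} | u. u \<in> B n}"
  by (auto simp: edges_back_graph less_Suc_eq insert_commute)

lemma edges_back_graph_subset: "e \<in> edges (back_graph B n) \<Longrightarrow> e \<subseteq> {..<n} \<and> card e = 2"
proof -
  assume "e \<in> edges (back_graph B n)"
  then obtain u b where "e = {u, b}" "u \<in> B b" "b < n" by (auto simp: edges_back_graph)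
  moreover from this have "u < b" using below[of b] by auto
  ultimately show ?thesis by auto
qed

lemma simple_back_graph: "simple_graph (back_graph B n)"
  using edges_back_graph_subset by (simp add: simple_graph_def)

text \<open>Layers that are initial segments induce graphs of the same kind, so a single edge count
  serves for all of them.\<close>

lemma edges_back_graph_prefix:
  assumes "m \<le> n"
  shows "{e \<in> edges (back_graph B n). e \<subseteq> {..<m}} = edges (back_graph B m)"
proof
  show "{e \<in> edges (back_graph B n). e \<subseteq> {..<m}} \<subseteq> edges (back_graph B m)"
    by (auto simp: edges_back_graph)
  show "edges (back_graph B m) \<subseteq> {e \<in> edges (back_graph B n). e \<subseteq> {..<m}}"
  proof
    fix e assume e: "e \<in> edges (back_graph B m)"
    then obtain u b where "e = {u, b}" "u \<in> B b" "b < n"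
      using assms by (auto simp: edges_back_graph)
    then have "e \<in> edges (back_graph B n)" unfolding edges_back_graph by blast
    then show "e \<in> {e \<in> edges (back_graph B n). e \<subseteq> {..<m}}"
      using edges_back_graph_subset[OF e] by simp
  qed
qed

lemma card_back_edges: "card {{n, u} | u. u \<in> B n} = card (B n)"
proof -
  have "{{n, u} | u. u \<in> B n} = (\<lambda>u. {n, u}) ` B n" by auto
  moreover have "inj_on (\<lambda>u. {n, u}) (B n)" by (auto simp: inj_on_def doubleton_eq_iff)
  ultimately show ?thesis by (simp add: card_image)
qed

text \<open>Each vertex from \<open>k\<close> on brings at least \<open>k\<close> new edges; the
  term \<open>k * k\<close> compensates for the first \<open>k\<close> vertices.\<close>

lemma card_edges_back_graph:
  assumes "\<And>b. k \<le> b \<Longrightarrow> b < n \<Longrightarrow> k \<le> card (B b)"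
  shows "k * n \<le> card (edges (back_graph B n)) + k * k"
  using assms
proof (induction n)
  case (Suc n)
  have "card (edges (back_graph B (Suc n))) = card (edges (back_graph B n)) + card (B n)"
    unfolding edges_back_graph_Suc
  proof (subst card_Un_disjoint)
    show "finite (edges (back_graph B n))"
      by (rule finite_subset[of _ "Pow {..<n}"]) (use edges_back_graph_subset in auto)
    show "finite {{n, u} | u. u \<in> B n}" using finite_back by simp
    show "edges (back_graph B n) \<inter> {{n, u} | u. u \<in> B n} = {}"
    proof (rule ccontr)
      assume "edges (back_graph B n) \<inter> {{n, u} | u. u \<in> B n} \<noteq> {}"
      then obtain u where "{n, u} \<in> edges (back_graph B n)" by auto
      then show False using edges_back_graph_subset[of "{n, u}" n] by simp
    qed
  qed (simp add: card_back_edges)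
  moreover have "k * n \<le> card (edges (back_graph B n)) + k * k" using Suc by simp
  \<comment> \<open>For \<open>n < k\<close> the additive \<open>k * k\<close> alone
    suffices.\<close>
  moreover have "k \<le> card (B n) \<or> k * Suc n \<le> k * k"
    using Suc.prems[of n] mult_le_mono2[of "Suc n" k k] by linarith
  ultimately show ?case by auto
qed simp

lemma degree_back_graph:
  assumes "b < m" "m \<le> n"
  shows "card (B b) \<le> card {e \<in> edges (back_graph B n). e \<subseteq> {..<m} \<and> b \<in> e}"
proof -
  have "{{b, u} | u. u \<in> B b} \<subseteq> {e \<in> edges (back_graph B n). e \<subseteq> {..<m} \<and> b \<in> e}"
  proof
    fix e assume "e \<in> {{b, u} | u. u \<in> B b}"
    then obtain u where u: "e = {b, u}" "u \<in> B b" by auto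
    then have "u < b" using below[of b] by auto
    then show "e \<in> {e \<in> edges (back_graph B n). e \<subseteq> {..<m} \<and> b \<in> e}"
      using u assms edge_back_graph_iff[of u b n] by (simp add: insert_commute)
  qed
  moreover have "finite {e \<in> edges (back_graph B n). e \<subseteq> {..<m} \<and> b \<in> e}"
    by (rule finite_subset[of _ "Pow {..<m}"]) auto
  ultimately show ?thesis using card_mono[of _ "{{b, u} | u. u \<in> B b}"] by (simp add: card_back_edges)
qed

text \<open>Vertices are added in numerical order, starting from the clique on
  \<open>0, ..., k\<close>. The cliques in use are the sets \<open>B j\<close> of the vertices added
  before, so injectivity of \<open>B\<close> beyond \<open>k\<close> says that none is used
  twice.\<close>

lemma simple_ktree_back_graph:
  assumes start: "\<And>b. b \<le> k \<Longrightarrow> B b = {..<b}"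
    and clique: "\<And>b. k < b \<Longrightarrow> b < n \<Longrightarrow> is_clique (back_graph B b) k (B b)"
    and inj: "inj_on B {k<..<n}"
    and "k < n"
  shows "simple_ktree_construction k (back_graph B n) (B ` {k<..<n})"
proof -
  have "simple_ktree_construction k (back_graph B b) (B ` {k<..<b})" if "Suc k \<le> b" "b \<le> n" for b
    using that
  proof (induction b rule: dec_induct)
    case base
    have "edges (back_graph B (Suc k)) = {e. e \<subseteq> {..<Suc k} \<and> card e = 2}"
    proof
      show "{e. e \<subseteq> {..<Suc k} \<and> card e = 2} \<subseteq> edges (back_graph B (Suc k))"
      proof
        fix e assume "e \<in> {e. e \<subseteq> {..<Suc k} \<and> card e = 2}"
        then obtain x y where xy: "e = {x, y}" "x \<noteq> y" "x < Suc k" "y < Suc k"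
          by (auto simp: card_2_iff)
        show "e \<in> edges (back_graph B (Suc k))"
        proof (cases "x < y")
          case True
          then show ?thesis using xy start[of y] edge_back_graph_iff[of x y] by simp
        next
          case False
          then show ?thesis
            using xy start[of x] edge_back_graph_iff[of y x] by (simp add: insert_commute)
        qed
      qed
    qed (use edges_back_graph_subset in auto)
    then have "back_graph B (Suc k) = complete_graph {..<Suc k}"
      by (simp add: complete_graph_def graph.expand)
    moreover have "{k<..<Suc k} = {}" by auto
    ultimately show ?case using simple_ktree_construction.start[of "{..<Suc k}" k] by simp
  next
    case (step b)
    have "B b \<notin> B ` {k<..<b}"
    proof
      assume "B b \<in> B ` {k<..<b}"
      then obtain j where "B b = B j" "k < j" "j < b" by auto
      then show False using inj_onD[OF inj, of b j] step by simp
    qed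
    then have "simple_ktree_construction k
        (Graph (insert b (verts (back_graph B b))) (edges (back_graph B b) \<union> {{b, u} | u. u \<in> B b}))
        (insert (B b) (B ` {k<..<b}))"
      using step clique[of b] by (intro simple_ktree_construction.add_vertex) simp_all
    moreover have "Graph (insert b (verts (back_graph B b)))
        (edges (back_graph B b) \<union> {{b, u} | u. u \<in> B b}) = back_graph B (Suc b)"
      by (rule graph.expand) (simp add: edges_back_graph_Suc lessThan_Suc)
    moreover have "insert (B b) (B ` {k<..<b}) = B ` {k<..<Suc b}"
    proof -
      have "{k<..<Suc b} = insert b {k<..<b}" using step by auto
      then show ?thesis by simp
    qed
    ultimately show ?case by simp
  qed
  then show ?thesis using \<open>k < n\<close> by simp
qed

end

section \<open>The witness and its two parameters\<close>

text \<open>Vertices below \<open>N + k\<close> form the \<open>k\<close>-th power of a path.  Vertex \<open>N + k + j\<close> is stacked onto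
  \<open>{j, \<dots>, j + k} - {j + 1}\<close>, a clique not used by the path as it is not an interval, and vertex
  \<open>2 * N + k + j\<close> onto the clique arising from this one by replacing \<open>j\<close> with \<open>N + k + j\<close>.\<close>
definition witness_nbh :: "nat \<Rightarrow> nat \<Rightarrow> nat \<Rightarrow> nat set" where
  "witness_nbh k N b =
    (if b < N + k then {b - k..<b}
     else if b < 2 * N + k then insert (b - (N + k)) {b - (N + k) + 2..b - (N + k) + k}
     else insert (b - N) {b - (2 * N + k) + 2..b - (2 * N + k) + k})"

context
  fixes k N :: nat
  assumes k: "2 \<le> k" and N: "0 < N"
begin

abbreviation "nbh \<equiv> witness_nbh k N"

lemma nbh_path: "b < N + k \<Longrightarrow> nbh b = {b - k..<b}"
  by (simp add: witness_nbh_def)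

lemma nbh_first: "j < N \<Longrightarrow> nbh (N + k + j) = insert j {j + 2..j + k}"
  by (simp add: witness_nbh_def)

lemma nbh_second: "nbh (2 * N + k + j) = insert (N + k + j) {j + 2..j + k}"
  by (simp add: witness_nbh_def add.assoc)

lemma layer_cases [consumes 1, case_names path first second]:
  assumes "b < 3 * N + k"
  obtains "b < N + k" | j where "j < N" "b = N + k + j" | j where "j < N" "b = 2 * N + k + j"
proof -
  consider "b < N + k" | "N + k \<le> b" "b < 2 * N + k" | "2 * N + k \<le> b" by linarith
  then show ?thesis
  proof cases
    case 2
    then show ?thesis using that(2)[of "b - (N + k)"] by simp
  next
    case 3
    then show ?thesis using that(3)[of "b - (2 * N + k)"] assms by simp
  qed (rule that(1))
qed

lemma nbh_below: "nbh b \<subseteq> {..<b}"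
proof -
  consider "b < N + k" | "N + k \<le> b" "b < 2 * N + k" | "2 * N + k \<le> b" by linarith
  then show ?thesis
  proof cases
    case 1
    then show ?thesis by (auto simp: nbh_path)
  next
    case 2
    then have "b - (N + k) < N" "N + k + (b - (N + k)) = b" by simp_all
    then have "nbh b = insert (b - (N + k)) {b - (N + k) + 2..b - (N + k) + k}"
      using nbh_first by metis
    then show ?thesis using 2 k N by auto
  next
    case 3
    then have "2 * N + k + (b - (2 * N + k)) = b" by simp
    then have "nbh b = insert (N + k + (b - (2 * N + k))) {b - (2 * N + k) + 2..b - (2 * N + k) + k}"
      using nbh_second by metis
    then show ?thesis using 3 k N by auto
  qed
qed

lemma card_nbh:
  assumes "k \<le> b" "b < 3 * N + k"
  shows "card (nbh b) = k"
  using assms(2)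
proof (cases rule: layer_cases)
  case path
  then show ?thesis using assms(1) by (simp add: nbh_path)
next
  case (first j)
  then show ?thesis using k by (simp add: nbh_first)
next
  case (second j)
  then show ?thesis using k N by (simp add: nbh_second)
qed

text \<open>Path vertices at distance at most \<open>k\<close> are adjacent, which settles the first
  two layers. In the last one, \<open>N + k + j\<close> is adjacent to
  \<open>{j + 2..j + k}\<close>, as these are among its own earlier neighbours.\<close>

lemma nbh_clique:
  assumes b: "b < 3 * N + k" and uv: "u \<in> nbh b" "v \<in> nbh b" "u < v"
  shows "u \<in> nbh v"
  using b
proof (cases rule: layer_cases)
  case path
  then have "v < b" "u \<ge> b - k" using uv by (simp_all add: nbh_path)
  then show ?thesis using path uv(3) nbh_path[of v] by auto
next
  case (first j)
  have "v \<le> j + k" "j \<le> u" using uv unfolding first(2) nbh_first[OF first(1)] by auto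
  then show ?thesis using first uv(3) nbh_path[of v] by auto
next
  case (second j)
  have uv': "u \<in> insert (N + k + j) {j + 2..j + k}" "v \<in> insert (N + k + j) {j + 2..j + k}"
    using uv(1,2) unfolding second(2) nbh_second .
  then have u: "u \<in> {j + 2..j + k}" using uv(3) second(1) by auto
  show ?thesis
  proof (cases "v = N + k + j")
    case True
    then show ?thesis using u nbh_first[OF second(1)] by simp
  next
    case False
    then have "v \<le> j + k" using uv'(2) by simp
    then show ?thesis using u uv(3) second(1) nbh_path[of v] by auto
  qed
qed

text \<open>The larger vertex \<open>b'\<close> leaves a mark in its set: on the path the element
  \<open>b' - 1\<close>, which is too large for \<open>nbh b\<close>; in the next layer the minimum
  \<open>j\<close> and the gap at \<open>j + 1\<close>; in the last layer the element
  \<open>N + k + j\<close> beyond the path.\<close>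

lemma inj_on_nbh: "inj_on nbh {k<..<3 * N + k}"
proof (rule linorder_inj_onI')
  fix b b' assume bb': "b \<in> {k<..<3 * N + k}" "b' \<in> {k<..<3 * N + k}" "b < b'"
  show "nbh b \<noteq> nbh b'"
  proof
    assume eq: "nbh b = nbh b'"
    from bb' have "b' < 3 * N + k" by simp
    then show False
    proof (cases rule: layer_cases)
      case path
      then have "b' - 1 \<in> nbh b'" using k bb' by (simp add: nbh_path)
      then have "b' - 1 \<in> nbh b" using eq by simp
      then show False using nbh_below[of b] bb' by auto
    next
      case (first j)
      note B' = nbh_first[OF first(1)]
      from bb' have "b < 3 * N + k" by simp
      then show False
      proof (cases rule: layer_cases)
        case path
        have "j \<in> nbh b" "j + 2 \<in> nbh b" using eq k first B' by simp_all
        then have "j + 1 \<in> nbh b" using path by (simp add: nbh_path)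
        then show False using eq first B' by simp
      next
        case b: (first i)
        have "i \<in> nbh b'" unfolding eq[symmetric] b(2) nbh_first[OF b(1)] by simp
        then have "j \<le> i" unfolding first(2) B' by auto
        then show False using b first bb' by simp
      next
        case (second i)
        then show False using first bb' by simp
      qed
    next
      case (second j)
      have "N + k + j \<in> nbh b'" unfolding second(2) nbh_second by simp
      then have mem: "N + k + j \<in> nbh b" using eq by simp
      from bb' have "b < 3 * N + k" by simp
      then show False
      proof (cases rule: layer_cases)
        case path
        then show False using mem nbh_below[of b] by auto
      next
        case (first i)
        then show False using mem nbh_first[OF first(1)] k by simp
      next
        case b: (second i)
        have "N + k + j \<in> insert (N + k + i) {i + 2..i + k}" using mem unfolding b(2) nbh_second .
        then have "i = j" using b(1) by auto
        then show False using b second bb' by simp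
      qed
    qed
  qed
qed

interpretation back_neighbours nbh
  by unfold_locales (rule nbh_below)

lemma simple_ktree_witness: "simple_ktree k (back_graph nbh (3 * N + k))"
proof -
  have "simple_ktree_construction k (back_graph nbh (3 * N + k)) (nbh ` {k<..<3 * N + k})"
  proof (rule simple_ktree_back_graph)
    show "nbh b = {..<b}" if "b \<le> k" for b using that N by (auto simp: nbh_path)
    fix b assume b: "k < b" "b < 3 * N + k"
    have "{u, v} \<in> edges (back_graph nbh b)" if uv: "u \<in> nbh b" "v \<in> nbh b" "u \<noteq> v" for u v
    proof (cases "u < v")
      case True
      then show ?thesis using nbh_clique[OF b(2) uv(1,2)] uv(2) nbh_below[of b]
        by (auto simp: edge_back_graph_iff)
    next
      case False
      then have "v < u" using uv(3) by simp
      then have "{v, u} \<in> edges (back_graph nbh b)"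
        using nbh_clique[OF b(2) uv(2,1)] uv(1) nbh_below[of b] by (auto simp: edge_back_graph_iff)
      then show ?thesis by (simp add: insert_commute)
    qed
    then show "is_clique (back_graph nbh b) k (nbh b)"
      using b card_nbh[of b] nbh_below[of b] finite_back[of b] by (simp add: is_clique_def)
  qed (use inj_on_nbh N in simp_all)
  then show ?thesis unfolding simple_ktree_def ..
qed

lemma stw_witness: "stw (back_graph nbh (3 * N + k)) \<le> k"
  unfolding stw_def
proof (rule Least_le, intro exI conjI)
  show "simple_ktree k (back_graph nbh (3 * N + k))" by (rule simple_ktree_witness)
  show "subgraph_of (back_graph nbh (3 * N + k)) (back_graph nbh (3 * N + k))"
    by (simp add: subgraph_of_def)
qed

text \<open>The three blocks of vertices serve as \<open>P\<close>, \<open>V\<close> and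
  \<open>W\<close>, and the matching is the shift by \<open>N\<close>. Fibres of size at most
  \<open>k\<close> would give \<open>N = card V\<close>, at most \<open>4 * (k * k)\<close>.\<close>

lemma ca_f_witness:
  assumes large: "4 * (k * k) < N"
  shows "k < ca_f (back_graph nbh (3 * N + k))"
proof (rule ccontr)
  let ?G = "back_graph nbh (3 * N + k)"
  assume "\<not> k < ca_f ?G"
  then have small: "ca_f ?G \<le> k" by simp
  obtain F :: "nat graph" and \<phi> where F: "caterpillar_forest F" "graph_hom \<phi> F ?G"
    "edge_surjective \<phi> F ?G" "ca_f ?G = max_fibre \<phi> F ?G"
    using ca_f_attained[OF simple_back_graph] by blast
  have fibre: "card {x \<in> verts F. \<phi> x = v} \<le> k" if "v \<in> verts ?G" for v
  proof -
    have "card {x \<in> verts F. \<phi> x = v} \<le> max_fibre \<phi> F ?G"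
      unfolding max_fibre_def using that by (intro Max_ge) auto
    then show ?thesis using F(4) small by simp
  qed
  let ?P = "{..<N + k}" and ?V = "{N + k..<2 * N + k}" and ?W = "{2 * N + k..<3 * N + k}"
  have PV: "?P \<union> ?V = {..<2 * N + k}" by auto
  have PVW: "{..<2 * N + k} \<union> ?W = {..<3 * N + k}" by auto
  have first: "nbh b \<subseteq> ?P" if "b \<in> ?V" for b
  proof -
    have "b - (N + k) < N" "b = N + k + (b - (N + k))" using that by auto
    then obtain j where "j < N" "b = N + k + j" by blast
    then show ?thesis using k by (auto simp: nbh_first)
  qed
  \<comment> \<open>The only earlier neighbour of \<open>b\<close> off the path is its partner
    \<open>b - N\<close>, written additively to avoid truncated subtraction.\<close>
  have second: "x \<in> nbh b \<Longrightarrow> x < N + k \<or> b = x + N" if "b \<in> ?W" for x b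
  proof -
    have "b - (2 * N + k) < N" "b = 2 * N + k + (b - (2 * N + k))" using that by auto
    then obtain j where "j < N" "b = 2 * N + k + j" by blast
    then show "x \<in> nbh b \<Longrightarrow> x < N + k \<or> b = x + N" by (auto simp: nbh_second)
  qed
  have edge: "x \<in> nbh y \<or> y \<in> nbh x" if "{x, y} \<in> edges ?G" for x y
    using that by (auto simp: edges_back_graph doubleton_eq_iff)
  \<comment> \<open>Used for the prefixes of length \<open>N + k\<close>, \<open>2 * N + k\<close>
    and \<open>3 * N + k\<close>; the defect is \<open>c = k * k\<close>, independent of
    \<open>N\<close>.\<close>
  have dense: "k * n \<le> card (edges (back_graph nbh n)) + k * k" if "n \<le> 3 * N + k" for n
    by (rule card_edges_back_graph) (use card_nbh that in simp)
  have "card ?V \<le> 4 * (k * k)"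
  proof (rule cover_layer_bound[OF simple_back_graph F(1-3) fibre, where P = ?P and W = ?W and w = "\<lambda>v. v + N"])
    show "verts ?G = ?P \<union> ?V \<union> ?W" unfolding PV PVW by simp
    show "?P \<inter> ?V = {}" by auto
    show "(?P \<union> ?V) \<inter> ?W = {}" unfolding PV by auto
    show "{b, b'} \<notin> edges ?G" if "b \<in> ?V" "b' \<in> ?V" for b b'
      using edge[of b b'] subsetD[OF first[OF that(1)], of b'] subsetD[OF first[OF that(2)], of b] that
      by auto
    show "{b, b'} \<notin> edges ?G" if "b \<in> ?W" "b' \<in> ?W" for b b'
      using edge[of b b'] second[OF that(1), of b'] second[OF that(2), of b] that by auto
    show "k \<le> card {e \<in> edges ?G. e \<subseteq> ?P \<union> ?V \<and> b \<in> e}" if "b \<in> ?V" for b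
      unfolding PV using degree_back_graph[of b "2 * N + k" "3 * N + k"] card_nbh[of b] that by simp
    show "k \<le> card {e \<in> edges ?G. e \<subseteq> ?P \<union> ?V \<union> ?W \<and> b \<in> e}" if "b \<in> ?W" for b
      unfolding PV PVW
      using degree_back_graph[of b "3 * N + k" "3 * N + k"] card_nbh[of b] that by simp
    show "k * card ?P \<le> card {e \<in> edges ?G. e \<subseteq> ?P} + k * k"
      using dense[of "N + k"] by (simp add: edges_back_graph_prefix)
    show "k * card (?P \<union> ?V) \<le> card {e \<in> edges ?G. e \<subseteq> ?P \<union> ?V} + k * k"
      unfolding PV using dense[of "2 * N + k"] by (simp add: edges_back_graph_prefix)
    show "k * card (verts ?G) \<le> card (edges ?G) + k * k"
      using dense[of "3 * N + k"] by simp
    show "inj_on (\<lambda>v. v + N) ?V" by simp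
    show "v + N \<in> ?W \<and> {v, v + N} \<in> edges ?G" if "v \<in> ?V" for v
    proof
      show W: "v + N \<in> ?W" using that by auto
      have "N + k \<le> v" using that by simp
      then obtain j where "v = N + k + j" by (auto simp only: le_iff_add)
      then have v: "v = N + k + j" "v + N = 2 * N + k + j" by simp_all
      have "v \<in> nbh (v + N)" unfolding v(2) nbh_second using v(1) by simp
      then show "{v, v + N} \<in> edges ?G" using N W by (simp add: edge_back_graph_iff)
    qed
    show "u = v + N" if "v \<in> ?V" "u \<in> ?W" "{v, u} \<in> edges ?G" for v u
      using edge[OF that(3)] second[OF that(2), of v] nbh_below[of v] that by auto
  qed
  then show False using large by simp
qed

end

theorem theorem17:
  fixes k :: nat
  assumes "2 \<le> k"
  shows "\<exists>G :: nat graph. simple_graph G \<and> stw G + 1 \<le> k + 1 \<and> k + 1 \<le> ca_f G"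
proof (intro exI conjI)
  \<comment> \<open>The least \<open>N\<close> above the bound \<open>4 * c\<close> with
    \<open>c = k * k\<close>.\<close>
  let ?N = "4 * (k * k) + 1"
  let ?G = "back_graph (witness_nbh k ?N) (3 * ?N + k)"
  interpret back_neighbours "witness_nbh k ?N"
    by unfold_locales (rule nbh_below[OF assms], simp)
  show "simple_graph ?G" by (rule simple_back_graph)
  show "stw ?G + 1 \<le> k + 1" using stw_witness[OF assms, of ?N] by simp
  show "k + 1 \<le> ca_f ?G" using ca_f_witness[OF assms, of ?N] by simp
qed

end
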